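(* Let $\Lambda=\{\lambda_k\}_{k\ge 0}$ be a non-decreasing sequence of positive numbers tending to $\infty$ and let $r\ge 2$ be an integer. Then the set $S(\Lambda^r)$ of functions, endowed with the norm $$\|f\|_{S(\Lambda^r)}=\sup_{n\ge0}\left\|\frac1{\lambda_n}\sum_{k=0}^n|\lambda_k s_k(f)-\lambda_{k-r}s_{k-r}(f)|\right\|_C,$$ is a Banach space.
   Context: $C$ is the Banach space of $2\pi$-periodic continuous complex-valued functions on $\mathbb R$ with norm $\|f\|_C=\max_t|f(t)|$. For $f\in C$ with Fourier series $\frac12a_0(f)+\sum_{k\ge1}(a_k(f)\cos kt+b_k(f)\sin kt)$, $s_k(f)=s_k(f,t)$ denotes the $k$th partial sum (so $s_0(f)=\frac12a_0(f)$). Convention: $\lambda_{-1}=\dots=\lambda_{-r}=0$ and $s_{-1}(f)=\dots=s_{-r}(f)=0$. A function $f\in C$ belongs to $S(\Lambda^r)$ if $$\lim_{n\to\infty}\left\|\frac1{\lambda_n}\sum_{k=0}^n|\lambda_k(s_k(f)-f)-\lambda_{k-r}(s_{k-r}(f)-f)|\right\|_C=0.$$ *)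

theory Defs
  imports "HOL-Analysis.Analysis" "HOL-Library.Function_Algebras"
begin

text \<open>
  The space \<open>C\<close> consists of the continuous \<open>2\<pi>\<close>-periodic functions; the supremum below
  is attained, hence a maximum, on continuous periodic functions. It is polymorphic in the
  codomain because it is also applied to real-valued sums of moduli.
\<close>

definition C_periodic :: "(real \<Rightarrow> complex) set" where
  "C_periodic = {f. continuous_on UNIV f \<and> (\<forall>t. f (t + 2 * pi) = f t)}"

definition C_norm :: "(real \<Rightarrow> 'a::real_normed_vector) \<Rightarrow> real" where
  "C_norm g = (SUP t. norm (g t))"

definition fourier_a :: "(real \<Rightarrow> complex) \<Rightarrow> nat \<Rightarrow> complex" where
  "fourier_a f k = integral {-pi..pi} (\<lambda>t. f t * complex_of_real (cos (real k * t))) / complex_of_real pi"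

definition fourier_b :: "(real \<Rightarrow> complex) \<Rightarrow> nat \<Rightarrow> complex" where
  "fourier_b f k = integral {-pi..pi} (\<lambda>t. f t * complex_of_real (sin (real k * t))) / complex_of_real pi"

definition fourier_sum :: "(real \<Rightarrow> complex) \<Rightarrow> nat \<Rightarrow> real \<Rightarrow> complex" where
  "fourier_sum f k t =
     fourier_a f 0 / 2 +
     (\<Sum>j=1..k. fourier_a f j * complex_of_real (cos (real j * t))
               + fourier_b f j * complex_of_real (sin (real j * t)))"

text \<open>
  \<open>lag r x k\<close> is \<open>x\<^bsub>k-r\<^esub>\<close> under the convention \<open>x\<^bsub>-1\<^esub> = \<dots> = x\<^bsub>-r\<^esub> = 0\<close>.
\<close>

definition lag :: "nat \<Rightarrow> (nat \<Rightarrow> 'a::zero) \<Rightarrow> nat \<Rightarrow> 'a" where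
  "lag r x k = (if r \<le> k then x (k - r) else 0)"

definition strong_dev :: "(nat \<Rightarrow> real) \<Rightarrow> nat \<Rightarrow> (real \<Rightarrow> complex) \<Rightarrow> nat \<Rightarrow> real \<Rightarrow> real" where
  "strong_dev \<Lambda> r f n t =
     1 / \<Lambda> n * (\<Sum>k=0..n. cmod (of_real (\<Lambda> k) * (fourier_sum f k t - f t)
                              - of_real (lag r \<Lambda> k) * (lag r (fourier_sum f) k t - f t)))"

definition strong_mean :: "(nat \<Rightarrow> real) \<Rightarrow> nat \<Rightarrow> (real \<Rightarrow> complex) \<Rightarrow> nat \<Rightarrow> real \<Rightarrow> real" where
  "strong_mean \<Lambda> r f n t =
     1 / \<Lambda> n * (\<Sum>k=0..n. cmod (of_real (\<Lambda> k) * fourier_sum f k t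
                              - of_real (lag r \<Lambda> k) * lag r (fourier_sum f) k t))"

definition S_space :: "(nat \<Rightarrow> real) \<Rightarrow> nat \<Rightarrow> (real \<Rightarrow> complex) set" where
  "S_space \<Lambda> r = {f \<in> C_periodic. (\<lambda>n. C_norm (strong_dev \<Lambda> r f n)) \<longlonglongrightarrow> 0}"

definition S_norm :: "(nat \<Rightarrow> real) \<Rightarrow> nat \<Rightarrow> (real \<Rightarrow> complex) \<Rightarrow> real" where
  "S_norm \<Lambda> r f = (SUP n. C_norm (strong_mean \<Lambda> r f n))"

text \<open>
  A complex Banach space whose carrier is a set: \<open>N\<close> need only behave as a norm on \<open>V\<close>.
  (The metric-space locale of the library is not used because it constrains the distance
  outside the carrier, where a real-valued supremum such as \<open>S_norm\<close> is unspecified.)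
\<close>

definition banach_space_on ::
  "(complex \<Rightarrow> 'v::ab_group_add \<Rightarrow> 'v) \<Rightarrow> 'v set \<Rightarrow> ('v \<Rightarrow> real) \<Rightarrow> bool" where
  "banach_space_on smul V N \<longleftrightarrow>
     vector_space smul \<and> module.subspace smul V \<and>
     (\<forall>x\<in>V. 0 \<le> N x) \<and>
     (\<forall>x\<in>V. N x = 0 \<longleftrightarrow> x = 0) \<and>
     (\<forall>c. \<forall>x\<in>V. N (smul c x) = cmod c * N x) \<and>
     (\<forall>x\<in>V. \<forall>y\<in>V. N (x + y) \<le> N x + N y) \<and>
     (\<forall>X. (\<forall>n. X n \<in> V) \<and> (\<forall>e>0. \<exists>M. \<forall>m\<ge>M. \<forall>n\<ge>M. N (X m - X n) < e)
        \<longrightarrow> (\<exists>x\<in>V. (\<lambda>n. N (X n - x)) \<longlonglongrightarrow> 0))"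

end

theory Submission imports Defs "HOL-Library.Periodic_Fun" begin

text \<open>
  With \<open>x\<^sub>k = \<lambda>\<^sub>k s\<^sub>k(f)\<close> or \<open>x\<^sub>k = \<lambda>\<^sub>k (s\<^sub>k(f) - f)\<close>, summing the differences
  \<open>x\<^sub>k - x\<^bsub>k-r\<^esub>\<close> along \<open>n, n - r, n - 2r, \<dots>\<close> gives \<open>|x\<^sub>n| \<le> \<Sum>\<^bsub>k\<le>n\<^esub> |x\<^sub>k - x\<^bsub>k-r\<^esub>|\<close>.
  Hence \<open>|s\<^sub>n(f)|\<close> is at most the norm of \<open>f\<close>, and \<open>s\<^sub>n(f) \<rightarrow> f\<close> uniformly for \<open>f\<close> in the
  space, so the norm dominates the uniform norm. On the other hand
  \<open>\<Sum>\<^bsub>k\<le>n\<^esub> (\<lambda>\<^sub>k - \<lambda>\<^bsub>k-r\<^esub>) \<le> r \<lambda>\<^sub>n\<close>, so the two strong means differ by at most \<open>r |f|\<close>.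
  A Cauchy sequence thus converges uniformly, and since \<open>s\<^sub>k\<close> is continuous
  in the uniform norm for each fixed \<open>k\<close>, the estimates pass to the limit.
\<close>

section \<open>Lagged differences\<close>

text \<open>Isolates the numerical content at a fixed point t. Both strong means are instances, with
  \<open>x k\<close> already carrying the weight \<open>\<Lambda> k\<close>, so each estimate is
  proved once for sequences.\<close>

definition lag_mean :: "(nat \<Rightarrow> real) \<Rightarrow> nat \<Rightarrow> (nat \<Rightarrow> complex) \<Rightarrow> nat \<Rightarrow> real" where
  "lag_mean \<Lambda> r x n = 1 / \<Lambda> n * (\<Sum>k=0..n. cmod (x k - lag r x k))"

lemma lag_mean_nonneg: "0 < \<Lambda> n \<Longrightarrow> 0 \<le> lag_mean \<Lambda> r x n"
  by (simp add: lag_mean_def sum_nonneg)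

text \<open>The lagged difference is linear in the sequence. Having both scalars in one inequality
  covers sums, differences and multiples alike.\<close>

lemma lag_mean_combination:
  assumes "0 < \<Lambda> n"
  shows "lag_mean \<Lambda> r (\<lambda>k. c * x k + d * y k) n
    \<le> cmod c * lag_mean \<Lambda> r x n + cmod d * lag_mean \<Lambda> r y n"
proof -
  have "cmod ((c * x k + d * y k) - lag r (\<lambda>k. c * x k + d * y k) k)
      \<le> cmod c * cmod (x k - lag r x k) + cmod d * cmod (y k - lag r y k)" for k
  proof -
    have "(c * x k + d * y k) - lag r (\<lambda>k. c * x k + d * y k) k
        = c * (x k - lag r x k) + d * (y k - lag r y k)"
      by (simp add: lag_def algebra_simps)
    then show ?thesis
      by (metis norm_mult norm_triangle_ineq)
  qed
  then have "(\<Sum>k=0..n. cmod ((c * x k + d * y k) - lag r (\<lambda>k. c * x k + d * y k) k))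
     \<le> cmod c * (\<Sum>k=0..n. cmod (x k - lag r x k)) + cmod d * (\<Sum>k=0..n. cmod (y k - lag r y k))"
    unfolding sum_distrib_left sum.distrib[symmetric] by (rule sum_mono)
  then have "1 / \<Lambda> n * (\<Sum>k=0..n. cmod ((c * x k + d * y k) - lag r (\<lambda>k. c * x k + d * y k) k))
     \<le> 1 / \<Lambda> n * (cmod c * (\<Sum>k=0..n. cmod (x k - lag r x k)) + cmod d * (\<Sum>k=0..n. cmod (y k - lag r y k)))"
    using assms by (intro mult_left_mono) auto
  then show ?thesis
    unfolding lag_mean_def by (simp add: algebra_simps)
qed

text \<open>Telescopes along the residue class of n modulo r down to an index below r, where the
  lagged term is 0. The terms of the other residue classes are only added.\<close>

lemma norm_le_sum_lag_diff:
  fixes x :: "nat \<Rightarrow> 'a::real_normed_vector"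
  assumes "0 < r"
  shows "norm (x n) \<le> (\<Sum>k=0..n. norm (x k - lag r x k))"
proof (induction n rule: less_induct)
  case (less n)
  show ?case
  proof (cases "n < r")
    case True
    then have "norm (x n) = norm (x n - lag r x n)"
      by (simp add: lag_def)
    also have "\<dots> \<le> (\<Sum>k=0..n. norm (x k - lag r x k))"
      by (rule member_le_sum) auto
    finally show ?thesis .
  next
    case False
    have "norm (x n) \<le> norm (x n - x (n - r)) + norm (x (n - r))"
      using norm_triangle_ineq[of "x n - x (n - r)" "x (n - r)"] by simp
    also have "\<dots> \<le> norm (x n - lag r x n) + (\<Sum>k=0..n-r. norm (x k - lag r x k))"
      using False assms less.IH[of "n - r"] by (simp add: lag_def)
    \<comment> \<open>Since r is positive, n lies outside \<open>{0..n-r}\<close>, so no term is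
      counted twice.\<close>
    also have "\<dots> = (\<Sum>k\<in>insert n {0..n-r}. norm (x k - lag r x k))"
      using False assms by (subst sum.insert) auto
    also have "\<dots> \<le> (\<Sum>k=0..n. norm (x k - lag r x k))"
      by (rule sum_mono2) auto
    finally show ?thesis .
  qed
qed

lemma norm_le_lag_mean:
  assumes "0 < r" "0 < \<Lambda> n"
  shows "cmod (x n) \<le> \<Lambda> n * lag_mean \<Lambda> r x n"
  using norm_le_sum_lag_diff[OF assms(1), of x n] assms(2) by (simp add: lag_mean_def)

text \<open>Everything cancels except the last r terms, those with indices n, n - 1, ..., n - r + 1.
  Induction on r splits a lag of r + 1 into a lag of r and one unit step, and the unit step
  telescopes in k.\<close>

lemma sum_lag_diff:
  fixes x :: "nat \<Rightarrow> 'a::ab_group_add"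
  shows "(\<Sum>k=0..n. x k - lag r x k) = (\<Sum>j<r. lag j x n)"
proof (induction r)
  case 0
  show ?case by (simp add: lag_def)
next
  case (Suc r)
  have "(\<Sum>k=0..n. lag r x k - lag (Suc r) x k) = lag r x n"
    by (induction n) (simp_all add: lag_def)
  then have "(\<Sum>k=0..n. (x k - lag r x k) + (lag r x k - lag (Suc r) x k))
      = (\<Sum>j<r. lag j x n) + lag r x n"
    by (simp only: sum.distrib Suc.IH)
  then show ?case by simp
qed

lemma lag_le:
  fixes \<Lambda> :: "nat \<Rightarrow> real"
  assumes "\<And>k. 0 < \<Lambda> k" "mono \<Lambda>"
  shows "lag r \<Lambda> k \<le> \<Lambda> k"
  using assms(1)[of k] monoD[OF assms(2), of "k - r" k] by (simp add: lag_def)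

text \<open>For a constant z the monotone weights make all differences nonnegative multiples of z,
  so the moduli can be summed exactly. The r surviving weights are each at most
  \<open>\<Lambda> n\<close>. This is the cost of exchanging the two strong means.\<close>

lemma lag_mean_weights_le:
  assumes "\<And>k. 0 < \<Lambda> k" "mono \<Lambda>"
  shows "lag_mean \<Lambda> r (\<lambda>k. of_real (\<Lambda> k) * z) n \<le> real r * cmod z"
proof -
  have "cmod (of_real (\<Lambda> k) * z - lag r (\<lambda>k. of_real (\<Lambda> k) * z) k) = (\<Lambda> k - lag r \<Lambda> k) * cmod z" for k
  proof -
    have "of_real (\<Lambda> k) * z - lag r (\<lambda>k. of_real (\<Lambda> k) * z) k = of_real (\<Lambda> k - lag r \<Lambda> k) * z"
      by (simp add: lag_def algebra_simps)
    then show ?thesis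
      using lag_le[OF assms, of r k] by (simp only: norm_mult norm_of_real)
  qed
  then have "lag_mean \<Lambda> r (\<lambda>k. of_real (\<Lambda> k) * z) n = 1 / \<Lambda> n * ((\<Sum>j<r. lag j \<Lambda> n) * cmod z)"
    by (simp add: lag_mean_def sum_distrib_right[symmetric] sum_lag_diff)
  also have "\<dots> \<le> 1 / \<Lambda> n * ((real r * \<Lambda> n) * cmod z)"
    using sum_bounded_above[of "{..<r}" "\<lambda>j. lag j \<Lambda> n" "\<Lambda> n"] lag_le[OF assms] assms(1)[of n]
    by (intro mult_left_mono mult_right_mono) auto
  also have "\<dots> = real r * cmod z"
    using assms(1)[of n] by simp
  finally show ?thesis .
qed

lemma strong_mean_eq_lag_mean:
  "strong_mean \<Lambda> r f n t = lag_mean \<Lambda> r (\<lambda>k. of_real (\<Lambda> k) * fourier_sum f k t) n"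
  unfolding strong_mean_def lag_mean_def
  by (intro arg_cong2[where f="(*)"] sum.cong refl) (simp add: lag_def)

text \<open>For k < r the second term of \<open>strong_dev\<close> is 0 times (0 - f(t)): the
  vanishing weight removes f(t), in agreement with the lag of the product.\<close>

lemma strong_dev_eq_lag_mean:
  "strong_dev \<Lambda> r f n t = lag_mean \<Lambda> r (\<lambda>k. of_real (\<Lambda> k) * (fourier_sum f k t - f t)) n"
  unfolding strong_dev_def lag_mean_def
  by (intro arg_cong2[where f="(*)"] sum.cong refl) (simp add: lag_def)

section \<open>Continuous periodic functions and their Fourier sums\<close>

text \<open>One period is compact, and every t is moved into it by a whole number of periods.
  Boundedness is what gives the real supremum in \<open>C_norm\<close> its meaning.\<close>

lemma C_periodic_bounded:
  assumes "f \<in> C_periodic"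
  obtains B where "\<And>t. cmod (f t) \<le> B"
proof -
  interpret periodic_fun_simple f "2 * pi"
    by standard (use assms in \<open>simp add: C_periodic_def\<close>)
  have "continuous_on {0..2*pi} f"
    using assms by (auto simp: C_periodic_def intro: continuous_on_subset)
  then have "bounded (f ` {0..2*pi})"
    by (intro compact_imp_bounded compact_continuous_image) auto
  then obtain B where B: "\<And>t. t \<in> {0..2*pi} \<Longrightarrow> cmod (f t) \<le> B"
    unfolding bounded_iff by blast
  have "cmod (f t) \<le> B" for t
  proof -
    define m where "m = \<lfloor>t / (2 * pi)\<rfloor>"
    have "of_int m \<le> t / (2 * pi)" "t / (2 * pi) < of_int m + 1"
      unfolding m_def by linarith+
    then have "t - of_int m * (2 * pi) \<in> {0..2*pi}"
      by (auto simp: field_simps)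
    then show ?thesis
      using B minus_of_int[of t m] by (metis)
  qed
  then show ?thesis using that by blast
qed

lemma C_periodic_combination:
  "f \<in> C_periodic \<Longrightarrow> g \<in> C_periodic \<Longrightarrow> (\<lambda>t. c * f t + d * g t) \<in> C_periodic"
  by (auto simp: C_periodic_def intro!: continuous_intros)

lemma integrable_C_periodic_mult:
  assumes "f \<in> C_periodic" "continuous_on UNIV h"
  shows "(\<lambda>t. f t * complex_of_real (h t)) integrable_on {a..b}"
  using assms unfolding C_periodic_def
  by (intro integrable_continuous_real continuous_intros) (auto intro: continuous_on_subset)

lemma integral_C_periodic_combination:
  assumes "f \<in> C_periodic" "g \<in> C_periodic" "continuous_on UNIV h"
  shows "integral {a..b} (\<lambda>t. (c * f t + d * g t) * complex_of_real (h t))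
    = c * integral {a..b} (\<lambda>t. f t * complex_of_real (h t))
      + d * integral {a..b} (\<lambda>t. g t * complex_of_real (h t))"
proof -
  have "(\<lambda>t. (c * f t + d * g t) * complex_of_real (h t))
      = (\<lambda>t. c * (f t * complex_of_real (h t)) + d * (g t * complex_of_real (h t)))"
    by (simp add: algebra_simps)
  then show ?thesis
    using assms
    by (simp add: integral_add integrable_on_mult_right integrable_C_periodic_mult)
qed

lemma fourier_sum_combination:
  assumes "f \<in> C_periodic" "g \<in> C_periodic"
  shows "fourier_sum (\<lambda>t. c * f t + d * g t) k t = c * fourier_sum f k t + d * fourier_sum g k t"
proof -
  have a: "fourier_a (\<lambda>t. c * f t + d * g t) j = c * fourier_a f j + d * fourier_a g j" for j
    unfolding fourier_a_def
    by (subst integral_C_periodic_combination[OF assms])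
      (auto intro!: continuous_intros simp: add_divide_distrib)
  have b: "fourier_b (\<lambda>t. c * f t + d * g t) j = c * fourier_b f j + d * fourier_b g j" for j
    unfolding fourier_b_def
    by (subst integral_C_periodic_combination[OF assms])
      (auto intro!: continuous_intros simp: add_divide_distrib)
  show ?thesis
    unfolding fourier_sum_def a b
    by (simp add: algebra_simps sum.distrib sum_distrib_left add_divide_distrib)
qed

lemma norm_integral_C_periodic_le:
  assumes "f \<in> C_periodic" "continuous_on UNIV h" "\<And>t. cmod (f t) \<le> B" "\<And>t. \<bar>h t\<bar> \<le> 1"
  shows "cmod (integral {-pi..pi} (\<lambda>t. f t * complex_of_real (h t)) / complex_of_real pi) \<le> 2 * B"
proof -
  have "cmod (f t * complex_of_real (h t)) \<le> B" for t
    using mult_mono[OF assms(3) assms(4), of t t] order_trans[OF norm_ge_zero assms(3)]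
    by (simp add: norm_mult)
  then have "cmod (integral {-pi..pi} (\<lambda>t. f t * complex_of_real (h t))) \<le> B * (pi - (- pi))"
    using assms(1,2) unfolding C_periodic_def
    by (intro integral_bound continuous_intros) (auto intro: continuous_on_subset)
  then show ?thesis
    by (simp add: norm_divide field_simps)
qed

text \<open>Every coefficient is at most 2B, so the constant term contributes B and each frequency
  4B. The growth in k is harmless, since the bound is applied to finitely many k at a time.\<close>

lemma norm_fourier_sum_le:
  assumes "f \<in> C_periodic" "\<And>t. cmod (f t) \<le> B"
  shows "cmod (fourier_sum f k t) \<le> (1 + 4 * real k) * B"
proof -
  have a: "cmod (fourier_a f j) \<le> 2 * B" and b: "cmod (fourier_b f j) \<le> 2 * B" for j
    unfolding fourier_a_def fourier_b_def
    by (intro norm_integral_C_periodic_le assms continuous_intros abs_cos_le_one abs_sin_le_one)+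
  have B: "0 \<le> B"
    using order_trans[OF norm_ge_zero assms(2)] .
  have "cmod (fourier_a f j * complex_of_real (cos (real j * t))
      + fourier_b f j * complex_of_real (sin (real j * t))) \<le> 2 * B * 1 + 2 * B * 1" for j
  proof (rule order_trans[OF norm_triangle_ineq], intro add_mono)
    show "cmod (fourier_a f j * complex_of_real (cos (real j * t))) \<le> 2 * B * 1"
      unfolding norm_mult norm_of_real by (intro mult_mono a) (use B in auto)
    show "cmod (fourier_b f j * complex_of_real (sin (real j * t))) \<le> 2 * B * 1"
      unfolding norm_mult norm_of_real by (intro mult_mono b) (use B in auto)
  qed
  then have "cmod (\<Sum>j=1..k. fourier_a f j * complex_of_real (cos (real j * t))
      + fourier_b f j * complex_of_real (sin (real j * t))) \<le> real k * (4 * B)"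
    by (intro order_trans[OF sum_norm_bound[where K="4 * B"]]) auto
  moreover have "cmod (fourier_a f 0 / 2) \<le> B"
    using a[of 0] by (simp add: norm_divide)
  ultimately show ?thesis
    unfolding fourier_sum_def
    by (intro order_trans[OF norm_triangle_ineq]) (simp add: algebra_simps)
qed

lemma C_norm_upper:
  assumes "\<And>t. norm (g t) \<le> B"
  shows "norm (g t) \<le> C_norm g"
  unfolding C_norm_def by (rule cSUP_upper) (auto intro: bdd_aboveI2 assms)

lemma C_norm_least: "(\<And>t. norm (g t) \<le> B) \<Longrightarrow> C_norm g \<le> B"
  unfolding C_norm_def by (rule cSUP_least) auto

lemma uniform_limit_C_periodic:
  assumes "\<And>n. X n \<in> C_periodic" "uniform_limit UNIV X f sequentially"
  shows "f \<in> C_periodic"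
proof -
  have "continuous_on UNIV f"
    by (rule uniform_limit_theorem[OF _ assms(2)]) (use assms(1) in \<open>auto simp: C_periodic_def\<close>)
  moreover have "f (t + 2 * pi) = f t" for t
  proof (rule LIMSEQ_unique)
    show "(\<lambda>n. X n (t + 2 * pi)) \<longlonglongrightarrow> f (t + 2 * pi)"
      by (rule tendsto_uniform_limitI[OF assms(2)]) simp
    show "(\<lambda>n. X n (t + 2 * pi)) \<longlonglongrightarrow> f t"
      using tendsto_uniform_limitI[OF assms(2), of t] assms(1) by (simp add: C_periodic_def)
  qed
  ultimately show ?thesis by (simp add: C_periodic_def)
qed

section \<open>The space of strongly convergent Fourier series\<close>

locale strong_summation =
  fixes \<Lambda> :: "nat \<Rightarrow> real" and r :: nat
  assumes pos: "\<And>k. 0 < \<Lambda> k" and mono: "mono \<Lambda>" and r_pos: "0 < r"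
begin

section \<open>Pointwise inequalities between the strong means and the partial sums\<close>

lemma strong_mean_nonneg: "0 \<le> strong_mean \<Lambda> r f n t"
  by (simp add: strong_mean_eq_lag_mean lag_mean_nonneg pos)

lemma strong_dev_nonneg: "0 \<le> strong_dev \<Lambda> r f n t"
  by (simp add: strong_dev_eq_lag_mean lag_mean_nonneg pos)

lemma strong_mean_combination:
  assumes "f \<in> C_periodic" "g \<in> C_periodic"
  shows "strong_mean \<Lambda> r (\<lambda>t. c * f t + d * g t) n t
    \<le> cmod c * strong_mean \<Lambda> r f n t + cmod d * strong_mean \<Lambda> r g n t"
  using lag_mean_combination[of \<Lambda> n r c "\<lambda>k. of_real (\<Lambda> k) * fourier_sum f k t"
      d "\<lambda>k. of_real (\<Lambda> k) * fourier_sum g k t", OF pos]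
  by (simp add: strong_mean_eq_lag_mean fourier_sum_combination[OF assms] algebra_simps)

lemma strong_dev_combination:
  assumes "f \<in> C_periodic" "g \<in> C_periodic"
  shows "strong_dev \<Lambda> r (\<lambda>t. c * f t + d * g t) n t
    \<le> cmod c * strong_dev \<Lambda> r f n t + cmod d * strong_dev \<Lambda> r g n t"
  using lag_mean_combination[of \<Lambda> n r c "\<lambda>k. of_real (\<Lambda> k) * (fourier_sum f k t - f t)"
      d "\<lambda>k. of_real (\<Lambda> k) * (fourier_sum g k t - g t)", OF pos]
  by (simp add: strong_dev_eq_lag_mean fourier_sum_combination[OF assms] algebra_simps)

text \<open>The two underlying sequences differ by \<open>\<Lambda> k\<close> times the fixed number
  f(t), whose lagged mean is at most r |f(t)|.\<close>

lemma strong_dev_le_mean: "strong_dev \<Lambda> r f n t \<le> strong_mean \<Lambda> r f n t + real r * cmod (f t)"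
  using lag_mean_combination[of \<Lambda> n r 1 "\<lambda>k. of_real (\<Lambda> k) * fourier_sum f k t"
      "-1" "\<lambda>k. of_real (\<Lambda> k) * f t", OF pos]
    lag_mean_weights_le[OF pos mono, of r "f t" n]
  by (simp add: strong_dev_eq_lag_mean strong_mean_eq_lag_mean algebra_simps)

lemma strong_mean_le_dev: "strong_mean \<Lambda> r f n t \<le> strong_dev \<Lambda> r f n t + real r * cmod (f t)"
  using lag_mean_combination[of \<Lambda> n r 1 "\<lambda>k. of_real (\<Lambda> k) * (fourier_sum f k t - f t)"
      1 "\<lambda>k. of_real (\<Lambda> k) * f t", OF pos]
    lag_mean_weights_le[OF pos mono, of r "f t" n]
  by (simp add: strong_dev_eq_lag_mean strong_mean_eq_lag_mean algebra_simps)

lemma norm_fourier_sum_le_mean: "cmod (fourier_sum f n t) \<le> strong_mean \<Lambda> r f n t"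
  using norm_le_lag_mean[where x="\<lambda>k. of_real (\<Lambda> k) * fourier_sum f k t" and \<Lambda>=\<Lambda> and n=n, OF r_pos pos]
    pos[of n]
  by (simp add: strong_mean_eq_lag_mean norm_mult)

text \<open>Makes the partial sums of every f in the space converge uniformly to f.\<close>

lemma norm_fourier_sum_diff_le_dev: "cmod (fourier_sum f n t - f t) \<le> strong_dev \<Lambda> r f n t"
  using norm_le_lag_mean[where x="\<lambda>k. of_real (\<Lambda> k) * (fourier_sum f k t - f t)" and \<Lambda>=\<Lambda> and n=n, OF r_pos pos]
    pos[of n]
  by (simp add: strong_dev_eq_lag_mean norm_mult)

section \<open>Uniform bounds at a fixed index\<close>

text \<open>For fixed n the strong mean involves finitely many partial sums, each bounded in the
  uniform norm. The constant K depends on n but not on f, B or t, which permits passing to uniform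
  limits.\<close>

lemma strong_mean_bound:
  obtains K where "\<And>f B t. f \<in> C_periodic \<Longrightarrow> (\<And>t. cmod (f t) \<le> B) \<Longrightarrow> strong_mean \<Lambda> r f n t \<le> K * B"
proof
  fix f B t
  assume f: "f \<in> C_periodic" "\<And>t. cmod (f t) \<le> B"
  let ?c = "\<lambda>k. \<Lambda> k * (1 + 4 * real k)"
  let ?x = "\<lambda>k. of_real (\<Lambda> k) * fourier_sum f k t"
  have x: "cmod (?x k) \<le> ?c k * B" for k
    using mult_left_mono[OF norm_fourier_sum_le[OF f, of k t], of "\<Lambda> k"] pos[of k]
    by (simp add: norm_mult mult.assoc)
  have "cmod (?x k - lag r ?x k) \<le> (?c k + lag r ?c k) * B" for k
    using norm_triangle_ineq4[of "?x k" "lag r ?x k"] x[of k] x[of "k - r"]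
    by (simp add: lag_def distrib_right split: if_splits)
  then have "(\<Sum>k=0..n. cmod (?x k - lag r ?x k)) \<le> (\<Sum>k=0..n. ?c k + lag r ?c k) * B"
    unfolding sum_distrib_right by (rule sum_mono)
  \<comment> \<open>The witness for K is determined here, as the factor in front of B.\<close>
  from mult_left_mono[OF this, of "1 / \<Lambda> n"]
  show "strong_mean \<Lambda> r f n t \<le> (1 / \<Lambda> n * (\<Sum>k=0..n. ?c k + lag r ?c k)) * B"
    using pos[of n] by (simp add: strong_mean_eq_lag_mean lag_mean_def mult.assoc)
qed

lemma strong_mean_le_C_norm:
  assumes "f \<in> C_periodic"
  shows "strong_mean \<Lambda> r f n t \<le> C_norm (strong_mean \<Lambda> r f n)"
proof -
  obtain B where B: "\<And>t. cmod (f t) \<le> B" using C_periodic_bounded[OF assms] by blast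
  obtain K where K: "\<And>f B t. f \<in> C_periodic \<Longrightarrow> (\<And>t. cmod (f t) \<le> B) \<Longrightarrow> strong_mean \<Lambda> r f n t \<le> K * B"
    using strong_mean_bound[of n] by blast
  show ?thesis
    using C_norm_upper[of "strong_mean \<Lambda> r f n" "K * B" t] K[OF assms B] strong_mean_nonneg
    by simp
qed

lemma strong_dev_le_C_norm:
  assumes "f \<in> C_periodic"
  shows "strong_dev \<Lambda> r f n t \<le> C_norm (strong_dev \<Lambda> r f n)"
proof -
  obtain B where B: "\<And>t. cmod (f t) \<le> B" using C_periodic_bounded[OF assms] by blast
  have "strong_dev \<Lambda> r f n t \<le> C_norm (strong_mean \<Lambda> r f n) + real r * B" for t
    using strong_dev_le_mean[of f n t] strong_mean_le_C_norm[OF assms, of n t]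
      mult_left_mono[OF B, of "real r" t]
    by simp
  then show ?thesis
    using C_norm_upper[of "strong_dev \<Lambda> r f n" "C_norm (strong_mean \<Lambda> r f n) + real r * B" t]
      strong_dev_nonneg
    by simp
qed

section \<open>Membership in the space and finiteness of its norm\<close>

text \<open>Trades the limit of suprema for a uniform epsilon condition, to which pointwise
  estimates apply directly. The weak inequality is the form that survives a supremum.\<close>

lemma S_space_iff:
  "f \<in> S_space \<Lambda> r \<longleftrightarrow>
    f \<in> C_periodic \<and> (\<forall>e>0. \<exists>M. \<forall>n\<ge>M. \<forall>t. strong_dev \<Lambda> r f n t \<le> e)"
proof (cases "f \<in> C_periodic")
  case True
  have nonneg: "0 \<le> C_norm (strong_dev \<Lambda> r f n)" for n
    using strong_dev_nonneg strong_dev_le_C_norm[OF True] by (rule order_trans)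
  have "(\<lambda>n. C_norm (strong_dev \<Lambda> r f n)) \<longlonglongrightarrow> 0 \<longleftrightarrow>
      (\<forall>e>0. \<exists>M. \<forall>n\<ge>M. \<forall>t. strong_dev \<Lambda> r f n t \<le> e)" (is "?L \<longleftrightarrow> ?R")
  proof
    assume ?L
    show ?R
    proof (intro allI impI)
      fix e :: real assume "0 < e"
      then obtain M where "\<forall>n\<ge>M. norm (C_norm (strong_dev \<Lambda> r f n) - 0) < e"
        using LIMSEQ_D[OF \<open>?L\<close>] by blast
      then have "\<forall>n\<ge>M. \<forall>t. strong_dev \<Lambda> r f n t \<le> e"
        using strong_dev_le_C_norm[OF True] by (fastforce intro: order_trans)
      then show "\<exists>M. \<forall>n\<ge>M. \<forall>t. strong_dev \<Lambda> r f n t \<le> e" ..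
    qed
  next
    assume ?R
    show ?L
    proof (rule LIMSEQ_I)
      fix e :: real assume "0 < e"
      then obtain M where "\<forall>n\<ge>M. \<forall>t. strong_dev \<Lambda> r f n t \<le> e / 2"
        using \<open>?R\<close> half_gt_zero by blast
      then have "\<forall>n\<ge>M. C_norm (strong_dev \<Lambda> r f n) \<le> e / 2"
        by (intro allI impI C_norm_least) (simp add: strong_dev_nonneg)
      then show "\<exists>M. \<forall>n\<ge>M. norm (C_norm (strong_dev \<Lambda> r f n) - 0) < e"
        using nonneg \<open>0 < e\<close> by (intro exI[of _ M]) fastforce
    qed
  qed
  then show ?thesis by (simp add: S_space_def)
qed (simp add: S_space_def)

lemma S_space_C_periodic: "f \<in> S_space \<Lambda> r \<Longrightarrow> f \<in> C_periodic"
  by (simp add: S_space_def)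

text \<open>The deviations converge to 0, hence are bounded in n, and the means exceed them by at
  most r times a bound of |f|.\<close>

lemma bdd_above_strong_mean:
  assumes "f \<in> S_space \<Lambda> r"
  shows "bdd_above (range (\<lambda>n. C_norm (strong_mean \<Lambda> r f n)))"
proof -
  obtain B where B: "\<And>t. cmod (f t) \<le> B"
    using C_periodic_bounded[OF S_space_C_periodic[OF assms]] by blast
  have "Bseq (\<lambda>n. C_norm (strong_dev \<Lambda> r f n))"
    using assms by (auto simp: S_space_def intro: convergent_imp_Bseq convergentI)
  then obtain D where D: "\<And>n. \<bar>C_norm (strong_dev \<Lambda> r f n)\<bar> \<le> D"
    by (auto simp: Bseq_def)
  have "strong_mean \<Lambda> r f n t \<le> D + real r * B" for n t
    using strong_mean_le_dev[of f n t] strong_dev_le_C_norm[OF S_space_C_periodic[OF assms], of n t]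
      D[of n] mult_left_mono[OF B, of "real r" t]
    by simp
  then have "C_norm (strong_mean \<Lambda> r f n) \<le> D + real r * B" for n
    by (intro C_norm_least) (simp add: strong_mean_nonneg)
  then show ?thesis by (rule bdd_aboveI2)
qed

lemma strong_mean_le_S_norm:
  assumes "f \<in> S_space \<Lambda> r"
  shows "strong_mean \<Lambda> r f n t \<le> S_norm \<Lambda> r f"
  unfolding S_norm_def
  by (rule order_trans[OF strong_mean_le_C_norm[OF S_space_C_periodic[OF assms]]
        cSUP_upper[OF _ bdd_above_strong_mean[OF assms]]]) simp

lemma S_norm_least: "(\<And>n t. strong_mean \<Lambda> r f n t \<le> B) \<Longrightarrow> S_norm \<Lambda> r f \<le> B"
  unfolding S_norm_def
  by (intro cSUP_least C_norm_least) (auto simp: strong_mean_nonneg)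

lemma S_norm_nonneg: "f \<in> S_space \<Lambda> r \<Longrightarrow> 0 \<le> S_norm \<Lambda> r f"
  using strong_mean_nonneg strong_mean_le_S_norm by (rule order_trans)

text \<open>Some partial sum is within e of f(t), and every partial sum is bounded by the norm. This
  yields definiteness and turns Cauchy sequences into uniformly Cauchy ones.\<close>

lemma norm_le_S_norm:
  assumes "f \<in> S_space \<Lambda> r"
  shows "cmod (f t) \<le> S_norm \<Lambda> r f"
proof (rule field_le_epsilon)
  fix e :: real assume "0 < e"
  then obtain M where "strong_dev \<Lambda> r f M t \<le> e"
    using assms unfolding S_space_iff by blast
  then have "cmod (fourier_sum f M t - f t) \<le> e"
    using norm_fourier_sum_diff_le_dev order_trans by blast
  moreover have "cmod (fourier_sum f M t) \<le> S_norm \<Lambda> r f"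
    using norm_fourier_sum_le_mean strong_mean_le_S_norm[OF assms] by (rule order_trans)
  ultimately show "cmod (f t) \<le> S_norm \<Lambda> r f + e"
    using norm_triangle_ineq4[of "fourier_sum f M t" "fourier_sum f M t - f t"] by simp
qed

section \<open>Linear structure and the norm axioms\<close>

lemma S_space_combination:
  assumes "f \<in> S_space \<Lambda> r" "g \<in> S_space \<Lambda> r"
  shows "(\<lambda>t. c * f t + d * g t) \<in> S_space \<Lambda> r"
  unfolding S_space_iff
proof (intro conjI allI impI)
  note C = S_space_C_periodic[OF assms(1)] S_space_C_periodic[OF assms(2)]
  show "(\<lambda>t. c * f t + d * g t) \<in> C_periodic"
    by (rule C_periodic_combination[OF C])
  fix e :: real assume "0 < e"
  \<comment> \<open>The summand 1 keeps K positive when both scalars vanish.\<close>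
  define K where "K = cmod c + cmod d + 1"
  have K: "0 < K" by (simp add: K_def add_nonneg_pos)
  with \<open>0 < e\<close> have "0 < e / K" by simp
  then obtain M N where M: "\<And>n t. n \<ge> M \<Longrightarrow> strong_dev \<Lambda> r f n t \<le> e / K"
    and N: "\<And>n t. n \<ge> N \<Longrightarrow> strong_dev \<Lambda> r g n t \<le> e / K"
    using assms unfolding S_space_iff by meson
  have "strong_dev \<Lambda> r (\<lambda>t. c * f t + d * g t) n t \<le> e" if "n \<ge> max M N" for n t
  proof -
    have "strong_dev \<Lambda> r (\<lambda>t. c * f t + d * g t) n t \<le> cmod c * (e / K) + cmod d * (e / K)"
      using that
      by (intro order_trans[OF strong_dev_combination[OF C]] add_mono mult_left_mono M N) auto
    also have "\<dots> \<le> K * (e / K)"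
      using \<open>0 < e / K\<close> by (simp only: K_def distrib_right)
    finally show ?thesis using K by simp
  qed
  then show "\<exists>M. \<forall>n\<ge>M. \<forall>t. strong_dev \<Lambda> r (\<lambda>t. c * f t + d * g t) n t \<le> e" by blast
qed

lemma S_norm_combination:
  assumes "f \<in> S_space \<Lambda> r" "g \<in> S_space \<Lambda> r"
  shows "S_norm \<Lambda> r (\<lambda>t. c * f t + d * g t) \<le> cmod c * S_norm \<Lambda> r f + cmod d * S_norm \<Lambda> r g"
  by (intro S_norm_least order_trans[OF strong_mean_combination] add_mono mult_left_mono
      strong_mean_le_S_norm S_space_C_periodic assms norm_ge_zero)

lemma zero_in_S_space: "(0 :: real \<Rightarrow> complex) \<in> S_space \<Lambda> r"
proof -
  have "fourier_sum (0 :: real \<Rightarrow> complex) k t = 0" for k t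
    by (simp add: fourier_sum_def fourier_a_def fourier_b_def)
  then have "strong_dev \<Lambda> r 0 n t = 0" for n t
    by (simp add: strong_dev_eq_lag_mean lag_mean_def lag_def)
  then show ?thesis
    by (simp add: S_space_iff C_periodic_def zero_fun_def)
qed

lemma S_space_add: "f \<in> S_space \<Lambda> r \<Longrightarrow> g \<in> S_space \<Lambda> r \<Longrightarrow> f + g \<in> S_space \<Lambda> r"
  using S_space_combination[of f g 1 1] by (simp add: plus_fun_def)

lemma S_space_scale: "f \<in> S_space \<Lambda> r \<Longrightarrow> (\<lambda>t. c * f t) \<in> S_space \<Lambda> r"
  using S_space_combination[of f f c 0] by simp

lemma S_space_diff: "f \<in> S_space \<Lambda> r \<Longrightarrow> g \<in> S_space \<Lambda> r \<Longrightarrow> f - g \<in> S_space \<Lambda> r"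
  using S_space_combination[of f g 1 "-1"] by (simp add: fun_diff_def)

lemma S_norm_add:
  "f \<in> S_space \<Lambda> r \<Longrightarrow> g \<in> S_space \<Lambda> r \<Longrightarrow> S_norm \<Lambda> r (f + g) \<le> S_norm \<Lambda> r f + S_norm \<Lambda> r g"
  using S_norm_combination[of f g 1 1] by (simp add: plus_fun_def)

lemma S_norm_scale:
  assumes "f \<in> S_space \<Lambda> r"
  shows "S_norm \<Lambda> r (\<lambda>t. c * f t) = cmod c * S_norm \<Lambda> r f"
proof (rule antisym)
  show le: "S_norm \<Lambda> r (\<lambda>t. c * f t) \<le> cmod c * S_norm \<Lambda> r f" for c
    using S_norm_combination[OF assms assms, of c 0] by simp
  show "cmod c * S_norm \<Lambda> r f \<le> S_norm \<Lambda> r (\<lambda>t. c * f t)"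
  proof (cases "c = 0")
    case True
    then show ?thesis using S_norm_nonneg[OF S_space_scale[OF assms, of c]] by simp
  next
    case False
    \<comment> \<open>The reverse inequality is the upper bound applied to the function c f with the
      scalar \<open>inverse c\<close>.\<close>
    then show ?thesis
      using S_norm_combination[OF S_space_scale[OF assms, of c] S_space_scale[OF assms, of c],
          of "inverse c" 0]
      by (simp add: norm_divide field_simps)
  qed
qed

lemma S_norm_eq_0_iff:
  assumes "f \<in> S_space \<Lambda> r"
  shows "S_norm \<Lambda> r f = 0 \<longleftrightarrow> f = 0"
proof
  assume "S_norm \<Lambda> r f = 0"
  then show "f = 0"
    using norm_le_S_norm[OF assms] by (simp add: fun_eq_iff)
next
  assume "f = 0"
  then show "S_norm \<Lambda> r f = 0"
    using S_norm_scale[OF assms, of 0] by (simp add: zero_fun_def)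
qed

section \<open>Completeness\<close>

text \<open>Writes g - f as (g - X p) + (X p - f). With n fixed, the mean of the second part is at
  most K times its uniform norm, which is arbitrarily small for large p.\<close>

lemma strong_mean_uniform_limit:
  assumes X: "\<And>p. X p \<in> C_periodic" and lim: "uniform_limit UNIV X f sequentially"
    and g: "g \<in> C_periodic"
    and bound: "\<And>p t. p \<ge> M \<Longrightarrow> strong_mean \<Lambda> r (g - X p) n t \<le> e"
  shows "strong_mean \<Lambda> r (g - f) n t \<le> e"
proof (rule field_le_epsilon)
  fix d :: real assume "0 < d"
  have f: "f \<in> C_periodic" by (rule uniform_limit_C_periodic[OF X lim])
  obtain K where K: "\<And>f B t. f \<in> C_periodic \<Longrightarrow> (\<And>t. cmod (f t) \<le> B) \<Longrightarrow> strong_mean \<Lambda> r f n t \<le> K * B"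
    using strong_mean_bound[of n] by blast
  \<comment> \<open>The sign of K is not known, so \<bar>K\<bar> + 1 serves as a positive upper
    bound for it.\<close>
  define \<delta> where "\<delta> = d / (\<bar>K\<bar> + 1)"
  have "0 < \<delta>" using \<open>0 < d\<close> by (simp add: \<delta>_def add_nonneg_pos)
  then have "\<forall>\<^sub>F p in sequentially. p \<ge> M \<and> (\<forall>t\<in>UNIV. dist (X p t) (f t) < \<delta>)"
    using uniform_limitD[OF lim] by (intro eventually_conj eventually_ge_at_top) auto
  then obtain p where p: "p \<ge> M" "\<And>t. dist (X p t) (f t) < \<delta>"
    using eventually_happens[of _ sequentially] by fastforce
  have diffs: "g - X p \<in> C_periodic" "X p - f \<in> C_periodic"
    using C_periodic_combination[OF g X, of 1 "-1" p] C_periodic_combination[OF X f, of 1 p "-1"]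
    by (simp_all add: fun_diff_def)
  have "strong_mean \<Lambda> r (X p - f) n t \<le> K * \<delta>"
    by (rule K[OF diffs(2)]) (use p(2) in \<open>simp add: dist_norm less_imp_le\<close>)
  also have "K * \<delta> \<le> (\<bar>K\<bar> + 1) * \<delta>"
    using \<open>0 < \<delta>\<close> by (intro mult_right_mono) auto
  also have "\<dots> = d"
    by (simp add: \<delta>_def add_nonneg_pos)
  finally have "strong_mean \<Lambda> r (X p - f) n t \<le> d" .
  moreover have "strong_mean \<Lambda> r (g - f) n t
      \<le> strong_mean \<Lambda> r (g - X p) n t + strong_mean \<Lambda> r (X p - f) n t"
    using strong_mean_combination[OF diffs, of 1 1 n t] by (simp add: fun_diff_def)
  ultimately show "strong_mean \<Lambda> r (g - f) n t \<le> e + d"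
    using bound[OF p(1), of t] by linarith
qed

lemma S_space_complete:
  assumes X: "\<And>n. X n \<in> S_space \<Lambda> r"
    and cauchy: "\<forall>e>0. \<exists>M. \<forall>m\<ge>M. \<forall>n\<ge>M. S_norm \<Lambda> r (X m - X n) < e"
  shows "\<exists>f\<in>S_space \<Lambda> r. (\<lambda>n. S_norm \<Lambda> r (X n - f)) \<longlonglongrightarrow> 0"
proof -
  note XC = S_space_C_periodic[OF X]
  have "uniformly_Cauchy_on UNIV X"
    unfolding uniformly_Cauchy_on_def dist_norm
    using cauchy norm_le_S_norm[OF S_space_diff[OF X X]]
    by (metis (no_types, lifting) fun_diff_def order_le_less_trans)
  then obtain f where lim: "uniform_limit UNIV X f sequentially"
    using Cauchy_uniformly_convergent uniformly_convergent_on_def by blast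
  have f: "f \<in> C_periodic" by (rule uniform_limit_C_periodic[OF XC lim])
  \<comment> \<open>The limit p to infinity is taken for each n separately, but M comes from the
    Cauchy condition alone, so the estimate is uniform in n and t.\<close>
  have close: "\<exists>M. \<forall>m\<ge>M. \<forall>n t. strong_mean \<Lambda> r (X m - f) n t \<le> e" if e: "0 < e" for e
  proof -
    obtain M where M: "\<And>m p. m \<ge> M \<Longrightarrow> p \<ge> M \<Longrightarrow> S_norm \<Lambda> r (X m - X p) < e"
      using cauchy e by blast
    have "strong_mean \<Lambda> r (X m - X p) n t \<le> e" if "m \<ge> M" "p \<ge> M" for m p n t
      using strong_mean_le_S_norm[OF S_space_diff[OF X X], of m p n t] M[OF that] by simp
    then have "strong_mean \<Lambda> r (X m - f) n t \<le> e" if "m \<ge> M" for m n t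
      using that by (intro strong_mean_uniform_limit[OF XC lim XC, of M]) auto
    then show ?thesis by blast
  qed
  have "f \<in> S_space \<Lambda> r"
    unfolding S_space_iff
  proof (intro conjI allI impI)
    show "f \<in> C_periodic" by (fact f)
    fix e :: real assume "0 < e"
    \<comment> \<open>Three errors add up to (2 + r) \<delta>: the deviation of \<open>X m\<close>,
      the strong mean of \<open>X m - f\<close>, and r times the uniform distance from
      \<open>X m\<close> to f.\<close>
    define \<delta> where "\<delta> = e / (2 + real r)"
    have "0 < \<delta>" using \<open>0 < e\<close> by (simp add: \<delta>_def add_pos_nonneg)
    obtain M where M: "\<And>m n t. m \<ge> M \<Longrightarrow> strong_mean \<Lambda> r (X m - f) n t \<le> \<delta>"
      using close[OF \<open>0 < \<delta>\<close>] by blast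
    have "\<forall>\<^sub>F m in sequentially. m \<ge> M \<and> (\<forall>t\<in>UNIV. dist (X m t) (f t) < \<delta>)"
      using uniform_limitD[OF lim \<open>0 < \<delta>\<close>] by (intro eventually_conj eventually_ge_at_top) auto
    then obtain m where m: "m \<ge> M" "\<And>t. dist (X m t) (f t) < \<delta>"
      using eventually_happens[of _ sequentially] by fastforce
    \<comment> \<open>The index m is now fixed, so N may depend on it.\<close>
    obtain N where N: "\<And>n t. n \<ge> N \<Longrightarrow> strong_dev \<Lambda> r (X m) n t \<le> \<delta>"
      using X[of m] \<open>0 < \<delta>\<close> unfolding S_space_iff by blast
    have diff: "X m - f \<in> C_periodic"
      using C_periodic_combination[OF XC f, of 1 m "-1"] by (simp add: fun_diff_def)
    have "strong_dev \<Lambda> r f n t \<le> e" if "n \<ge> N" for n t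
    proof -
      have "strong_dev \<Lambda> r f n t \<le> strong_dev \<Lambda> r (X m) n t + strong_dev \<Lambda> r (X m - f) n t"
        using strong_dev_combination[OF XC diff, of 1 m "-1" n t] by (simp add: fun_diff_def)
      also have "\<dots> \<le> \<delta> + (\<delta> + real r * \<delta>)"
        using m(2)[of t] M[OF m(1), of n t]
        by (intro add_mono N that order_trans[OF strong_dev_le_mean] mult_left_mono)
          (auto simp: dist_norm)
      also have "\<dots> = (2 + real r) * \<delta>"
        by (simp add: algebra_simps)
      also have "\<dots> = e"
        by (simp add: \<delta>_def add_pos_nonneg)
      finally show ?thesis .
    qed
    then show "\<exists>N. \<forall>n\<ge>N. \<forall>t. strong_dev \<Lambda> r f n t \<le> e" by blast
  qed
  moreover have "(\<lambda>n. S_norm \<Lambda> r (X n - f)) \<longlonglongrightarrow> 0"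
  proof (rule LIMSEQ_I)
    fix e :: real assume "0 < e"
    then obtain M where M: "\<And>m n t. m \<ge> M \<Longrightarrow> strong_mean \<Lambda> r (X m - f) n t \<le> e / 2"
      using close[of "e / 2"] by auto
    have "norm (S_norm \<Lambda> r (X m - f) - 0) < e" if "m \<ge> M" for m
      using S_norm_least[of "X m - f" "e / 2"] M[OF that] \<open>0 < e\<close>
        S_norm_nonneg[OF S_space_diff[OF X \<open>f \<in> S_space \<Lambda> r\<close>], of m]
      by simp
    then show "\<exists>M. \<forall>m\<ge>M. norm (S_norm \<Lambda> r (X m - f) - 0) < e" by blast
  qed
  ultimately show ?thesis by blast
qed

lemma banach_space_on_S_space:
  "banach_space_on (\<lambda>c f t. c * f t) (S_space \<Lambda> r) (S_norm \<Lambda> r)"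
proof -
  interpret V: vector_space "\<lambda>c (f :: real \<Rightarrow> complex) t. c * f t"
    by standard (simp_all add: fun_eq_iff algebra_simps)
  have "V.subspace (S_space \<Lambda> r)"
    by (simp add: V.subspace_def zero_in_S_space S_space_add S_space_scale)
  then show ?thesis
    unfolding banach_space_on_def
    using V.vector_space_axioms
    by (simp add: S_norm_nonneg S_norm_eq_0_iff S_norm_scale S_norm_add S_space_complete)
qed

end

text \<open>The boundedness conjunct certifies that \<open>S_norm\<close> is a genuine finite
  supremum on the space, since a real \<open>SUP\<close> over an unbounded set carries no
  information.\<close>

theorem theorem3:
  fixes \<Lambda> :: "nat \<Rightarrow> real" and r :: nat
  assumes "\<And>k. 0 < \<Lambda> k"
    and "mono \<Lambda>"
    and "filterlim \<Lambda> at_top sequentially"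
    and "r \<ge> 2"
  shows "(\<forall>f\<in>S_space \<Lambda> r. bdd_above (range (\<lambda>n. C_norm (strong_mean \<Lambda> r f n)))) \<and>
         banach_space_on (\<lambda>c f t. c * f t) (S_space \<Lambda> r) (S_norm \<Lambda> r)"
proof -
  interpret strong_summation \<Lambda> r
    by standard (use assms in auto)
  show ?thesis
    by (intro conjI ballI bdd_above_strong_mean banach_space_on_S_space)
qed

end
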